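(* Let $N\ge 2$ and $q\ge 1$ be integers. Let $A=[a_{ij}]_{0\le i,j\le N-1}$ and $B=[b_{ij}]_{0\le i,j\le N-1}$ be complex unitary $N\times N$ matrices all of whose first-row entries equal $1/\sqrt N$, and let $(W_{n,A})_{n\ge0}$, $(W_{n,B})_{n\ge0}$ be the associated generalized Walsh functions. For $i\in\{1,\dots,N\}$ let $\mathrm{row}_{i,A}\in\mathbb C^N$ denote the $i$-th row of $A$ (so $\mathrm{row}_{i,A}=(a_{i-1,0},\dots,a_{i-1,N-1})$), and similarly for $B$. Then the following two conditions are equivalent: (1) $\langle W_{l,B},W_{k,A}\rangle=\langle W_{l,A},W_{k,B}\rangle$ for all $k,l\in\{0,1,\dots,N^q-1\}$, with inner products in $L^2[0,1]$; (2) $\langle \mathrm{row}_{l,B},\mathrm{row}_{k,A}\rangle=\langle \mathrm{row}_{l,A},\mathrm{row}_{k,B}\rangle$ for all $k,l\in\{1,2,\dots,N\}$, with the usual inner product of $\mathbb C^N$.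
   Context: Inner products are linear in the first variable: $\langle f,g\rangle=\int_0^1 f(t)\overline{g(t)}\,dt$ on $L^2[0,1]$ and $\langle u,v\rangle=\sum_j u_j\overline{v_j}$ on $\mathbb C^N$. Generalized Walsh functions. Let $C=[c_{ij}]_{0\le i,j\le N-1}$ be a complex unitary $N\times N$ matrix with $c_{0j}=1/\sqrt N$ for all $j$. For $0\le i\le N-1$ let $m_i(x)=\sqrt N\sum_{j=0}^{N-1}c_{ij}\chi_{[j/N,(j+1)/N)}(x)$ for $x\in[0,1)$, so $m_0\equiv 1$. Let $r(x)=(Nx)\bmod 1$, i.e. $r(x)=Nx-l$ for $x\in[l/N,(l+1)/N)$, $l\in\{0,\dots,N-1\}$. At the endpoint $x=1$ the convention is $r(1)=1$ and $m_i(1)=\sqrt N c_{i,N-1}$. For an integer $n\ge 0$ with base-$N$ expansion $n=\sum_{k=0}^{p-1}i_kN^k$, $i_k\in\{0,\dots,N-1\}$, set $$W_{n,C}(x)=m_{i_0}(x)\,m_{i_1}(r x)\cdots m_{i_{p-1}}(r^{p-1}x),$$ where $r^k$ is the $k$-fold iterate of $r$; $W_{0,C}\equiv1$. *)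

theory Defs
  imports
    "HOL-Analysis.Analysis"
    "Jordan_Normal_Form.Schur_Decomposition"
begin

definition unitary_mat :: "nat \<Rightarrow> complex mat \<Rightarrow> bool" where
  "unitary_mat N C \<longleftrightarrow> C \<in> carrier_mat N N \<and>
     C * mat_adjoint C = 1\<^sub>m N \<and> mat_adjoint C * C = 1\<^sub>m N"

text \<open>Functions on the unit interval are total functions on the reals; their values outside
  \<open>{0..1}\<close> carry no meaning and are never used. At the endpoint \<open>1\<close> the functions below are
  continued from the left.\<close>

definition filter_fun :: "nat \<Rightarrow> complex mat \<Rightarrow> nat \<Rightarrow> real \<Rightarrow> complex" where
  "filter_fun N C i x =
     (if x = 1 then complex_of_real (sqrt (real N)) * C $$ (i, N - 1)
      else complex_of_real (sqrt (real N)) *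
        (\<Sum>j<N. C $$ (i, j) * indicator {real j / real N ..< real (j + 1) / real N} x))"

definition shift_map :: "nat \<Rightarrow> real \<Rightarrow> real" where
  "shift_map N x = (if x = 1 then 1 else frac (real N * x))"

text \<open>The number of base-\<open>N\<close> digits of \<open>n\<close>, for \<open>N \<ge> 2\<close>; it is \<open>0\<close> for \<open>n = 0\<close>.\<close>

definition num_digits :: "nat \<Rightarrow> nat \<Rightarrow> nat" where
  "num_digits N n = (LEAST p. n < N ^ p)"

definition digit :: "nat \<Rightarrow> nat \<Rightarrow> nat \<Rightarrow> nat" where
  "digit N n k = n div N ^ k mod N"

definition walsh :: "nat \<Rightarrow> complex mat \<Rightarrow> nat \<Rightarrow> real \<Rightarrow> complex" where
  "walsh N C n x =
     (\<Prod>k<num_digits N n. filter_fun N C (digit N n k) ((shift_map N ^^ k) x))"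

definition L2_inner :: "(real \<Rightarrow> complex) \<Rightarrow> (real \<Rightarrow> complex) \<Rightarrow> complex" where
  "L2_inner f g = (LINT t:{0..1}|lborel. f t * cnj (g t))"

end

theory Submission
  imports Defs
begin

text \<open>
  A generalized Walsh function is constant on the \<open>N\<close>-adic intervals: its factor of index \<open>k\<close>
  only sees the \<open>k\<close>-th base-\<open>N\<close> digit of the point \<open>x\<close>. Under Lebesgue measure on the unit
  interval these digits are independent and uniformly distributed, so the integral of a
  product of functions of single digits is the product of their averages
  (\<open>has_integral_digit_product\<close>). For two Walsh functions whose indices have at most \<open>p\<close> digits
  the average belonging to position \<open>d\<close> is an inner product of two matrix rows, so that
  the inner product of \<open>W\<^bsub>l,B\<^esub>\<close> and \<open>W\<^bsub>k,A\<^esub>\<close> is the product over \<open>d < p\<close> of the inner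
  products of row \<open>l\<^sub>d\<close> of \<open>B\<close> and row \<open>k\<^sub>d\<close> of \<open>A\<close>,
  where \<open>l\<^sub>d\<close> and \<open>k\<^sub>d\<close> are the base-\<open>N\<close> digits (\<open>L2_inner_walsh\<close>). Indices with fewer than
  \<open>p\<close> digits may be padded with zeros because the first row of each matrix gives the constant
  function \<open>1\<close>.

  The symmetry of the row products therefore passes factor by factor to the Walsh functions.
  Conversely, the indices below \<open>N\<close> have at most one digit, and for them the product formula with
  \<open>p = 1\<close> identifies the Walsh inner products with the row products.
\<close>

lemma shift_map_unit_interval:
  assumes "0 \<le> x" "x < 1"
  shows "0 \<le> shift_map N x" "shift_map N x < 1"
  using assms by (auto simp: shift_map_def frac_lt_1)

lemma funpow_shift_map_unit_interval:
  assumes "0 \<le> x" "x < 1"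
  shows "0 \<le> (shift_map N ^^ k) x \<and> (shift_map N ^^ k) x < 1"
  by (induction k) (use assms in \<open>auto intro: shift_map_unit_interval\<close>)

lemma floor_scaled_less:
  fixes x :: real
  assumes "0 \<le> x" "x < 1" "N > 0"
  shows "nat \<lfloor>real N * x\<rfloor> < N"
proof -
  have "real N * x < real N" using assms by simp
  then show ?thesis using assms by (simp add: nat_less_iff floor_less_iff)
qed

lemma floor_scaled_eq_iff:
  fixes x :: real
  assumes "0 \<le> x" "N > 0"
  shows "nat \<lfloor>real N * x\<rfloor> = j \<longleftrightarrow> real j \<le> real N * x \<and> real N * x < real j + 1"
proof -
  have "nat \<lfloor>real N * x\<rfloor> = j \<longleftrightarrow> \<lfloor>real N * x\<rfloor> = int j"
    using assms by (auto simp: nat_eq_iff)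
  then show ?thesis by (simp add: floor_eq_iff)
qed

text \<open>
  On the \<open>j\<close>-th of the \<open>N\<close> subintervals the shift is the affine bijection \<open>x \<mapsto> N x - j\<close> onto
  the unit interval, and it scales lengths by \<open>N\<close>. Hence each subinterval contributes
  \<open>c j * I / N\<close>: the first digit is independent of the shifted point.
\<close>

lemma has_integral_first_digit_times_shift:
  fixes h :: "real \<Rightarrow> complex" and c :: "nat \<Rightarrow> complex"
  assumes "N > 0"
    and h: "has_bochner_integral lborel (\<lambda>x. indicator {0..<1} x *\<^sub>R h x) I"
  shows "has_bochner_integral lborel
           (\<lambda>x. indicator {0..<1} x *\<^sub>R (c (nat \<lfloor>real N * x\<rfloor>) * h (shift_map N x)))
           ((\<Sum>j<N. c j) / of_nat N * I)"
proof -
  let ?f = "\<lambda>x. indicator {0..<1} x *\<^sub>R h x"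
  have "has_bochner_integral lborel (\<lambda>x. ?f (- real j + real N * x)) (I /\<^sub>R \<bar>real N\<bar>)" for j
    using lborel_has_bochner_integral_real_affine_iff[of "real N" ?f I "- real j"] assms by simp
  then have "has_bochner_integral lborel (\<lambda>x. \<Sum>j<N. c j * ?f (- real j + real N * x))
      (\<Sum>j<N. c j * (I /\<^sub>R \<bar>real N\<bar>))"
    by (intro has_bochner_integral_sum has_bochner_integral_mult_right)
  moreover have "(\<Sum>j<N. c j * (I /\<^sub>R \<bar>real N\<bar>)) = (\<Sum>j<N. c j) / of_nat N * I"
    by (simp add: scaleR_conv_of_real divide_inverse mult.assoc mult.commute[of I]
        flip: sum_distrib_right)
  moreover have "(\<Sum>j<N. c j * ?f (- real j + real N * x)) =
      indicator {0..<1} x *\<^sub>R (c (nat \<lfloor>real N * x\<rfloor>) * h (shift_map N x))" for x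
  proof (cases "0 \<le> x \<and> x < 1")
    case True
    define i where "i = nat \<lfloor>real N * x\<rfloor>"
    have "i < N" unfolding i_def using floor_scaled_less True assms(1) by blast
    have ind: "indicator {0..<1} (- real j + real N * x) = (if j = i then 1 else 0 :: real)" for j
    proof -
      have "- real j + real N * x \<in> {0..<1} \<longleftrightarrow> j = i"
        using floor_scaled_eq_iff[of x N j] True assms(1) unfolding i_def atLeastLessThan_iff
        by linarith
      then show ?thesis unfolding indicator_def by simp
    qed
    have "shift_map N x = - real i + real N * x"
      using True by (simp add: shift_map_def frac_def i_def)
    moreover have "(\<Sum>j<N. c j * ?f (- real j + real N * x)) =
        (\<Sum>j<N. if j = i then c i * h (- real i + real N * x) else 0)"
      by (rule sum.cong) (simp_all only: ind, auto)
    ultimately show ?thesis using True \<open>i < N\<close> by (simp add: i_def)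
  next
    case False
    have "- real j + real N * x \<notin> {0..<1}" if "j < N" for j
    proof (cases "x < 0")
      case True
      then have "real N * x < 0" using assms(1) by (simp add: mult_pos_neg)
      then show ?thesis by auto
    next
      case nonneg: False
      then have "real N \<le> real N * x" using False assms(1) by simp
      moreover have "real j + 1 \<le> real N" using that by simp
      ultimately show ?thesis unfolding atLeastLessThan_iff by linarith
    qed
    then have "(\<Sum>j<N. c j * ?f (- real j + real N * x)) = 0" by (intro sum.neutral) simp
    then show ?thesis using False by auto
  qed
  ultimately show ?thesis by simp
qed

text \<open>
  The induction on the number of digits peels off the first one. The remaining product is a
  product of the same shape, for the shifted sequence of digit functions, evaluated at the
  shifted point.
\<close>

lemma has_integral_digit_product:
  fixes c :: "nat \<Rightarrow> nat \<Rightarrow> complex"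
  assumes "N > 0"
  shows "has_bochner_integral lborel
           (\<lambda>x. indicator {0..<1} x *\<^sub>R (\<Prod>k<p. c k (nat \<lfloor>real N * (shift_map N ^^ k) x\<rfloor>)))
           (\<Prod>k<p. (\<Sum>j<N. c k j) / of_nat N)"
proof (induction p arbitrary: c)
  case 0
  have "has_bochner_integral lborel (\<lambda>x::real. indicator {0..<1} x *\<^sub>R (1::complex))
      (measure lborel {0..<1::real} *\<^sub>R 1)"
    by (rule has_bochner_integral_indicator) auto
  then show ?case by simp
next
  case (Suc p)
  show ?case
    using has_integral_first_digit_times_shift[OF assms Suc.IH[of "\<lambda>k. c (Suc k)"], of "c 0"]
    by (simp add: prod.lessThan_Suc_shift funpow_Suc_right del: funpow.simps(2) prod.lessThan_Suc)
qed

lemma filter_fun_eq_entry: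
  assumes "0 \<le> x" "x < 1" "N > 0"
  shows "filter_fun N C i x = complex_of_real (sqrt (real N)) * C $$ (i, nat \<lfloor>real N * x\<rfloor>)"
proof -
  let ?d = "nat \<lfloor>real N * x\<rfloor>"
  have ind: "indicator {real j / real N ..< real (j + 1) / real N} x = (if j = ?d then 1 else 0 :: complex)"
    for j
    using floor_scaled_eq_iff[of x N j] assms by (auto simp: indicator_def field_simps)
  have "(\<Sum>j<N. C $$ (i, j) * indicator {real j / real N ..< real (j + 1) / real N} x) =
      (\<Sum>j<N. if j = ?d then C $$ (i, ?d) else 0)"
    by (rule sum.cong) (simp_all only: ind, simp_all)
  also have "\<dots> = C $$ (i, ?d)" using floor_scaled_less[OF assms] by simp
  finally show ?thesis using assms(2) by (simp add: filter_fun_def)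
qed

lemma digit_eq_0:
  assumes "N \<ge> 2" "num_digits N n \<le> k"
  shows "digit N n k = 0"
proof -
  have "n < N ^ n" using assms(1) by (intro power_gt_expt) simp
  then have "n < N ^ num_digits N n" unfolding num_digits_def by (rule LeastI)
  also have "\<dots> \<le> N ^ k" using assms by (intro power_increasing) auto
  finally show ?thesis by (simp add: digit_def)
qed

text \<open>
  Every number below \<open>N ^ p\<close> may be treated as if it had exactly \<open>p\<close> digits: a leading zero
  contributes the factor \<open>sqrt N * (1 / sqrt N) = 1\<close>.
\<close>

lemma walsh_eq_padded_product:
  assumes "N \<ge> 2" "n < N ^ p" "\<forall>j<N. C $$ (0, j) = complex_of_real (1 / sqrt (real N))"
    and "0 \<le> x" "x < 1"
  shows "walsh N C n x = (\<Prod>k<p. complex_of_real (sqrt (real N)) *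
           C $$ (digit N n k, nat \<lfloor>real N * (shift_map N ^^ k) x\<rfloor>))"
proof -
  let ?y = "\<lambda>k. (shift_map N ^^ k) x"
  have y: "0 \<le> ?y k" "?y k < 1" for k
    using funpow_shift_map_unit_interval[OF assms(4,5)] by auto
  have "filter_fun N C (digit N n k) (?y k) = 1" if "num_digits N n \<le> k" for k
    using filter_fun_eq_entry[OF y] floor_scaled_less[OF y] digit_eq_0[OF assms(1) that] assms(1,3)
    by (simp flip: of_real_mult)
  moreover have "num_digits N n \<le> p" unfolding num_digits_def by (rule Least_le) (fact assms(2))
  ultimately have "walsh N C n x = (\<Prod>k<p. filter_fun N C (digit N n k) (?y k))"
    unfolding walsh_def by (intro prod.mono_neutral_left) auto
  then show ?thesis using filter_fun_eq_entry[OF y] assms(1) by simp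
qed

text \<open>
  On \<open>{0..<1}\<close> the integrand is a product of functions of single digits. The two factors
  \<open>sqrt N\<close> at each position give \<open>N\<close>, which cancels the \<open>1 / N\<close> of the average over the digit
  values and leaves exactly the row product.
\<close>

lemma L2_inner_walsh:
  assumes "N \<ge> 2" "B \<in> carrier_mat N N" "A \<in> carrier_mat N N"
    and "\<forall>j<N. B $$ (0, j) = complex_of_real (1 / sqrt (real N))"
    and "\<forall>j<N. A $$ (0, j) = complex_of_real (1 / sqrt (real N))"
    and "l < N ^ p" "k < N ^ p"
  shows "L2_inner (walsh N B l) (walsh N A k) =
           (\<Prod>d<p. row B (digit N l d) \<bullet>c row A (digit N k d))"
proof -
  let ?F = "\<lambda>x. walsh N B l x * cnj (walsh N A k x)"
  define c where "c = (\<lambda>d j. of_nat N * (B $$ (digit N l d, j) * cnj (A $$ (digit N k d, j))))"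
  have sqrt_N: "complex_of_real (sqrt (real N)) * complex_of_real (sqrt (real N)) = of_nat N"
    by (simp flip: of_real_mult)
  have F: "?F x = (\<Prod>d<p. c d (nat \<lfloor>real N * (shift_map N ^^ d) x\<rfloor>))" if "x \<in> {0..<1}" for x
  proof -
    have regroup: "s * b * cnj (s * a) = s * s * (b * cnj a)"
      if "cnj s = s" for s a b :: complex
      using that by simp
    show ?thesis
      using that walsh_eq_padded_product[OF assms(1,6,4), of x]
        walsh_eq_padded_product[OF assms(1,7,5), of x]
      by (simp only: cnj_prod prod.distrib[symmetric] regroup complex_cnj_complex_of_real
          sqrt_N c_def atLeastLessThan_iff)
  qed
  have "digit N n d < N" for n d using assms(1) by (simp add: digit_def)
  then have avg: "(\<Sum>j<N. c d j) / of_nat N = row B (digit N l d) \<bullet>c row A (digit N k d)" for d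
    using assms(1-3)
    by (simp add: c_def scalar_prod_def sum_distrib_left[symmetric] atLeast0LessThan)
  have "has_bochner_integral lborel (\<lambda>x. indicator {0..<1} x *\<^sub>R ?F x)
      (\<Prod>d<p. row B (digit N l d) \<bullet>c row A (digit N k d))"
  proof -
    have "(\<lambda>x. indicator {0..<1} x *\<^sub>R ?F x) = (\<lambda>x. indicator {0..<1} x *\<^sub>R
        (\<Prod>d<p. c d (nat \<lfloor>real N * (shift_map N ^^ d) x\<rfloor>)))"
      by (rule ext) (use F in \<open>simp split: split_indicator\<close>)
    then show ?thesis using has_integral_digit_product[of N c p] assms(1) by (simp add: avg)
  qed
  \<comment> \<open>The digit description breaks down at the endpoint \<open>1\<close>, a null set that is added separately.\<close>
  moreover have "has_bochner_integral lborel (\<lambda>x::real. indicator {1} x *\<^sub>R ?F 1)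
      (measure lborel {1::real} *\<^sub>R ?F 1)"
    by (rule has_bochner_integral_indicator) auto
  ultimately have "has_bochner_integral lborel
      (\<lambda>x. indicator {0..<1} x *\<^sub>R ?F x + indicator {1} x *\<^sub>R ?F 1)
      ((\<Prod>d<p. row B (digit N l d) \<bullet>c row A (digit N k d)) + measure lborel {1::real} *\<^sub>R ?F 1)"
    by (rule has_bochner_integral_add)
  moreover have "(\<lambda>x. indicator {0..<1} x *\<^sub>R ?F x + indicator {1} x *\<^sub>R ?F 1) =
      (\<lambda>x. indicator {0..1} x *\<^sub>R ?F x)"
    by (rule ext) (simp split: split_indicator)
  ultimately show ?thesis
    by (simp add: L2_inner_def set_lebesgue_integral_def has_bochner_integral_integral_eq)
qed

theorem theorem3p5:
  fixes N q :: nat and A B :: "complex mat"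
  assumes "N \<ge> 2" and "q \<ge> 1"
    and "unitary_mat N A" and "unitary_mat N B"
    and "\<forall>j<N. A $$ (0, j) = complex_of_real (1 / sqrt (real N))"
    and "\<forall>j<N. B $$ (0, j) = complex_of_real (1 / sqrt (real N))"
  shows "(\<forall>k\<in>{0..N ^ q - 1}. \<forall>l\<in>{0..N ^ q - 1}.
            L2_inner (walsh N B l) (walsh N A k) = L2_inner (walsh N A l) (walsh N B k))
     \<longleftrightarrow> (\<forall>k\<in>{1..N}. \<forall>l\<in>{1..N}.
            row B (l - 1) \<bullet>c row A (k - 1) = row A (l - 1) \<bullet>c row B (k - 1))"
    (is "?walsh \<longleftrightarrow> ?rows")
proof
  have carrier: "A \<in> carrier_mat N N" "B \<in> carrier_mat N N"
    using assms(3,4) by (auto simp: unitary_mat_def)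
  note BA = L2_inner_walsh[OF assms(1) carrier(2,1) assms(6,5)]
  note AB = L2_inner_walsh[OF assms(1) carrier assms(5,6)]
  {
    assume walsh: ?walsh
    show ?rows
    proof (intro ballI)
      fix k l assume "k \<in> {1..N}" "l \<in> {1..N}"
      then have less: "k - 1 < N" "l - 1 < N" by auto
      have "N \<le> N ^ q" using assms(1,2) self_le_power[of N q] by simp
      then have "k - 1 \<in> {0..N ^ q - 1}" "l - 1 \<in> {0..N ^ q - 1}" using less by auto
      then have "L2_inner (walsh N B (l - 1)) (walsh N A (k - 1)) =
          L2_inner (walsh N A (l - 1)) (walsh N B (k - 1))"
        using walsh by blast
      then show "row B (l - 1) \<bullet>c row A (k - 1) = row A (l - 1) \<bullet>c row B (k - 1)"
        using BA[of "l - 1" 1 "k - 1"] AB[of "l - 1" 1 "k - 1"] less by (simp add: digit_def)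
    qed
  next
    assume rows: ?rows
    have sym: "row B i \<bullet>c row A j = row A i \<bullet>c row B j" if "i < N" "j < N" for i j
      using rows[rule_format, of "Suc j" "Suc i"] that by simp
    show ?walsh
    proof (intro ballI)
      fix k l assume "k \<in> {0..N ^ q - 1}" "l \<in> {0..N ^ q - 1}"
      moreover have "N ^ q > 0" using assms(1) by simp
      ultimately have less: "k < N ^ q" "l < N ^ q" unfolding atLeastAtMost_iff by linarith+
      have "digit N n d < N" for n d using assms(1) by (simp add: digit_def)
      then show "L2_inner (walsh N B l) (walsh N A k) = L2_inner (walsh N A l) (walsh N B k)"
        using BA[OF less(2,1)] AB[OF less(2,1)] sym by simp
    qed
  }
qed

end
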